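(* Suppose Assumptions A and S (see context) hold. Then for all $\Delta t$ with $1-\mu\Delta t\ge c_0>0$ (where $\mu$ is the upper bound of $\partial^o_yf$ in Assumption S), all $\alpha\in\mathbf A^M$ and all $u\in\mathbb R^M$, the matrix $\mathcal L^\alpha[u]$ (see context) is nonsingular and satisfies $|\mathcal L^\alpha[u]^{-1}|_0\le1/c_0$. Consequently, the iterates $\{u^{(k)}\}$ generated by the policy iteration algorithm (see context) converge superlinearly to the solution $u^*$ of $\mathcal G[u]=0$ in a neighbourhood of $u^*$; that is, there is a neighbourhood of $u^*$ such that if the initial iterate $u^{(0)}$ lies in it, then $u^{(k)}\to u^*$ and $|u^{(k+1)}-u^*|_0=o(|u^{(k)}-u^*|_0)$ as $k\to\infty$.
   Context: Fix $T>0$ and dimensions $d,n$; $\bar{\mathcal Q}_T=[0,T]\times\mathbb R^d$, $E=\mathbb R^n\setminus\{0\}$, $\nu$ a Lévy measure on $E$ ($\int_E(1\wedge|e|^2)\nu(de)<\infty$). $|h|_0=\sup|h|$, $|h|_1=\sup_{t,\,x\ne x'}|h(t,x)-h(t,x')|/|x-x'|$, $\|h\|_1=|h|_0+|h|_1$ (similarly for time-independent functions). On $\mathbb R^M$, $|\cdot|_0$ is the max norm, and on matrices the induced operator norm. $a^+=\max(a,0)$. Data: $b^\alpha:\bar{\mathcal Q}_T\to\mathbb R^d$, $\sigma^\alpha:\bar{\mathcal Q}_T\to\mathbb R^{d\times d}$, $\eta^\alpha:\bar{\mathcal Q}_T\times E\to\mathbb R^d$, $\gamma:\bar{\mathcal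 Q}_T\times E\to\mathbb R$, $\zeta:\bar{\mathcal Q}_T\to\mathbb R$, $g:\mathbb R^d\to\mathbb R$, $m:\mathbb R\to\mathbb R$, $f:\mathbf A\times\bar{\mathcal Q}_T\times\mathbb R\times\mathbb R^d\times\mathbb R\to\mathbb R$; $\rho\ge0$. Assumption A. $\mathbf A$ is a compact subset of a metric space, and there exist $C>0$, $\mu\in\mathbb R$ such that for all $(\alpha,e,t,x,z,k)$ and $y,y'\in\mathbb R$: (1) $b^\alpha,\sigma^\alpha,\eta^\alpha$ are continuous in $\alpha,t$; $\gamma,\zeta$ are continuous in $t$; $g(x)\ge\zeta(0,x)$; $\gamma\ge0$; $\|b^\alpha\|_1+\|\sigma^\alpha\|_1+\|\zeta\|_1+\|g\|_1\le C$; $\|\eta^\alpha(\cdot,\cdot,e)\|_1+|\gamma(\cdot,\cdot,e)|_0\le C(1\wedge|e|)$; $|\gamma(\cdot,\cdot,e)|_1\le C(1\wedge|e|^2)$. (2) $f$ is continuous; $|f^\alpha(t,x,0,0,0)|\le C$; there is a continuous increasing $\varphi:[0,\infty)\to[0,\infty)$ with $(y-y')(f^\alpha(t,x,y,z,k)-f^\alpha(t,x,y',z,k))\le\mu|y-y'|^2$ and $|f^\alpha(t,x,y,z,k)|\le|f^\alpha(t,x,0,0,0)|+\varphi(|y|)+C(|z|+|k|)$; $k\mapsto f^\alpha(t,x,y,z,k)$ is non-decreasing; $f$ is Lipschitz in $x,z,k$ with constant $C$, uniformly in $\alpha,t,y$. (3) $m$ is Lipschitz continuous, non-decreasing, $m(0)=0$.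 Assumption S. There is a function $\partial^o_yf:\mathbf A\times\bar{\mathcal Q}_T\times\mathbb R\times\mathbb R^d\times\mathbb R\to\mathbb R$ (also written $\partial^o_yf^\alpha(t,x,y,z,k)$), bounded above by some constant $\mu\in\mathbb R$, such that for any $(t,x,y)\in\bar{\mathcal Q}_T\times\mathbb R$ and any compact $\mathcal K\subset\mathbf A\times\mathbb R^d\times\mathbb R$ there exist a neighbourhood $\mathcal U_y$ of $y$ and a constant $C_y>0$ with: (i) the family $\{\partial^o_yf(\cdot,t,x,v,\cdot,\cdot)\}_{v\in\mathcal U_y}$ is equicontinuous and uniformly bounded by $C_y$ with respect to $(\alpha,z,k)\in\mathcal K$; (ii) uniformly in $(\alpha,z,k)\in\mathcal K$, $$\lim_{s\to0}\frac{f^\alpha(t,x,y+s,z,k)-f^\alpha(t,x,y,z,k)-\partial^o_yf(\alpha,t,x,y+s,z,k)\,s}{s}=0.$$ Discrete problem. Let $M\in\mathbb N$, $\mathcal I=\{1,\dots,M\}$, $x_i$ ($i\in\mathcal I$) grid points with mesh size $h$, $\Delta t>0$ a time step, $t_n$ a fixed time, and $u^n\in\mathbb R^M$ given. $A^\alpha_{r,h}$ ($M\times M$ matrices), $K^\alpha_{r,h}$, $B^\alpha_{r,h}$ are the discrete operators (finite-dimensional, boundary-modified monotone discretizations of the local, nonlocal and nonlinear nonlocal operators, with jumps of size at most $r$ truncated), and $\Delta u^n_i$ is the central difference vector of $u^n$ at node $i$. They are assumed continuous in $\alpha$, and for each $\alpha$, $-A^\alpha_{r,h}$ has positive diagonals,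 nonpositive off-diagonals and nonnegative row sums. Set $\bar f^\alpha(t_n,x_i,y,\Delta u^n_i,k)=f^\alpha(t_n,x_i,y,\sigma_r^\alpha(t_n,x_i)^T\Delta u^n_i/(2h),k)+d_i$, where $d_i$ is the Lax–Friedrichs numerical viscosity term, depending only on $u^n$ and discretization parameters (not on $y$, $k$, $\alpha$), and $\sigma^\alpha_r$ equals $\sigma^\alpha$ off the diagonal and $\sigma^\alpha_{r,jj}=((\sigma^\alpha_{jj})^2+\int_{|e|<r}|\eta^\alpha_j|^2\nu(de))^{1/2}$ on it; $\bar f^\alpha$ is continuous in $\alpha$. Set $\tilde f^\alpha(t_n,x_i,y,z,k)=\bar f^\alpha(t_n,x_i,y,z,k)+\rho(\zeta(t_n,x_i)-y)^+$. For $u\in\mathbb R^M$, $\alpha\in\mathbf A$, $i\in\mathcal I$ define $$\mathcal G^\alpha[u]_i=u_i-u^n_i-\Delta t\Big((A^\alpha_{r,h}u)_i+(K^\alpha_{r,h}u^n)_i+\tilde f^\alpha(t_n,x_i,u_i,\Delta u^n_i,(B^\alpha_{r,h}u^n)_i)\Big),\qquad \mathcal G[u]_i=\inf_{\alpha\in\mathbf A}\mathcal G^\alpha[u]_i .$$ For $\alpha=(\alpha_i)\in\mathbf A^M$ and $u\in\mathbb R^M$, $P^\alpha[u]$ is the diagonal matrix with entries $\partial^o_yf^{\alpha_i}(t_n,x_i,u_i,\sigma_r^{\alpha_i}(t_n,x_i)^T\Delta u^n_i/(2h),(B^{\alpha_i}_{r,h}u^n)_i)$, $V^+[u]$ is the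 diagonal matrix with entries $-\rho\,1_{\{\zeta(t_n,x_i)-u_i>0\}}$, and $\mathcal L^\alpha[u]\in\mathbb R^{M\times M}$ has $i$-th row $$\mathcal L^\alpha[u]_i=(I-\Delta tA^{\alpha_i}_{r,h})_i-\Delta t\big(P^\alpha[u]_i+V^+[u]_i\big).$$ Policy iteration algorithm. Given an initial iterate $u^{(0)}$ and $u^{(k)}$, $k\ge0$: choose $\alpha^{(k+1)}=(\alpha^{(k+1)}_i)_{i\in\mathcal I}$ with $\alpha^{(k+1)}_i\in\arg\min_{\alpha\in\mathbf A}\mathcal G^\alpha[u^{(k)}]_i$ for each $i$; then let $u^{(k+1)}$ solve $\mathcal G[u^{(k)}]+\mathcal L^{\alpha^{(k+1)}}[u^{(k)}](u^{(k+1)}-u^{(k)})=0$. *)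

theory Defs
  imports "HOL-Analysis.Analysis" "HOL-Library.Landau_Symbols"
begin

section \<open>Norms\<close>

text \<open>
  The suprema are taken in \<^typ>\<open>ennreal\<close>, so that a bound by a real constant
  really expresses boundedness (the real-valued supremum of an unbounded set is unspecified).
  Time-independent functions are treated as functions that are constant in time.
\<close>

definition norm0 :: "real \<Rightarrow> (real \<Rightarrow> real^'d \<Rightarrow> 'b::real_normed_vector) \<Rightarrow> ennreal" where
  "norm0 T w = (SUP t\<in>{0..T}. SUP x. ennreal (norm (w t x)))"

definition lip1 :: "real \<Rightarrow> (real \<Rightarrow> real^'d \<Rightarrow> 'b::real_normed_vector) \<Rightarrow> ennreal" where
  "lip1 T w = (SUP t\<in>{0..T}. SUP x. SUP x'\<in>- {x}.
      ennreal (norm (w t x - w t x') / norm (x - x')))"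

definition norm1 :: "real \<Rightarrow> (real \<Rightarrow> real^'d \<Rightarrow> 'b::real_normed_vector) \<Rightarrow> ennreal" where
  "norm1 T w = norm0 T w + lip1 T w"

text \<open>The max norm on vectors is the library's \<^const>\<open>infnorm\<close>; this is its induced operator norm.\<close>

definition matrix_norm0 :: "real^'m^'m \<Rightarrow> real" where
  "matrix_norm0 Q = (SUP v\<in>{v. infnorm v \<le> 1}. infnorm (Q *v v))"


section \<open>The continuous problem\<close>

record ('a, 'd::finite, 'n::finite) control_data =
  horizon :: real                                            \<comment> \<open>\<open>T\<close>\<close>
  levy :: "(real^'n) measure"                                \<comment> \<open>\<open>\<nu>\<close>\<close>
  controls :: "'a set"                                       \<comment> \<open>\<open>\<^bold>A\<close>\<close>
  drift :: "'a \<Rightarrow> real \<Rightarrow> real^'d \<Rightarrow> real^'d"                \<comment> \<open>\<open>b\<close>\<close>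
  vol :: "'a \<Rightarrow> real \<Rightarrow> real^'d \<Rightarrow> real^'d^'d"               \<comment> \<open>\<open>\<sigma>\<close>\<close>
  jumps :: "'a \<Rightarrow> real \<Rightarrow> real^'d \<Rightarrow> real^'n \<Rightarrow> real^'d"      \<comment> \<open>\<open>\<eta>\<close>\<close>
  intensity :: "real \<Rightarrow> real^'d \<Rightarrow> real^'n \<Rightarrow> real"          \<comment> \<open>\<open>\<gamma>\<close>\<close>
  obstacle :: "real \<Rightarrow> real^'d \<Rightarrow> real"                      \<comment> \<open>\<open>\<zeta>\<close>\<close>
  payoff :: "real^'d \<Rightarrow> real"                                \<comment> \<open>\<open>g\<close>\<close>
  mfun :: "real \<Rightarrow> real"                                     \<comment> \<open>\<open>m\<close>\<close>
  driver :: "'a \<Rightarrow> real \<Rightarrow> real^'d \<Rightarrow> real \<Rightarrow> real^'d \<Rightarrow> real \<Rightarrow> real"  \<comment> \<open>\<open>f\<^sup>\<alpha>(t,x,y,z,k)\<close>\<close>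
  penalty :: real                                            \<comment> \<open>\<open>\<rho>\<close>\<close>

definition levy_measure :: "(real^'n) measure \<Rightarrow> bool" where
  "levy_measure \<nu> \<longleftrightarrow> sets \<nu> = sets (restrict_space borel (- {0})) \<and>
     (\<integral>\<^sup>+ e. ennreal (min 1 ((norm e)\<^sup>2)) \<partial>\<nu>) < \<infinity>"

definition assumption_A_coeffs :: "('a::metric_space, 'd::finite, 'n::finite) control_data \<Rightarrow> real \<Rightarrow> bool" where
  "assumption_A_coeffs D C \<longleftrightarrow>
     (let T = horizon D; A = controls D; b = drift D; \<sigma> = vol D; \<eta> = jumps D;
          \<gamma> = intensity D; \<zeta> = obstacle D; g = payoff D in
     (\<forall>x. continuous_on (A \<times> {0..T}) (\<lambda>(\<alpha>, t). b \<alpha> t x)) \<and>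
     (\<forall>x. continuous_on (A \<times> {0..T}) (\<lambda>(\<alpha>, t). \<sigma> \<alpha> t x)) \<and>
     (\<forall>x. \<forall>e\<in>- {0}. continuous_on (A \<times> {0..T}) (\<lambda>(\<alpha>, t). \<eta> \<alpha> t x e)) \<and>
     (\<forall>x. \<forall>e\<in>- {0}. continuous_on {0..T} (\<lambda>t. \<gamma> t x e)) \<and>
     (\<forall>x. continuous_on {0..T} (\<lambda>t. \<zeta> t x)) \<and>
     (\<forall>x. g x \<ge> \<zeta> 0 x) \<and>
     (\<forall>t\<in>{0..T}. \<forall>x. \<forall>e\<in>- {0}. \<gamma> t x e \<ge> 0) \<and>
     (\<forall>\<alpha>\<in>A. norm1 T (b \<alpha>) + norm1 T (\<sigma> \<alpha>) + norm1 T \<zeta> + norm1 T (\<lambda>_. g) \<le> ennreal C) \<and>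
     (\<forall>\<alpha>\<in>A. \<forall>e\<in>- {0}. norm1 T (\<lambda>t x. \<eta> \<alpha> t x e) + norm0 T (\<lambda>t x. \<gamma> t x e)
        \<le> ennreal (C * min 1 (norm e))) \<and>
     (\<forall>e\<in>- {0}. lip1 T (\<lambda>t x. \<gamma> t x e) \<le> ennreal (C * min 1 ((norm e)\<^sup>2))))"

definition assumption_A_driver :: "('a::metric_space, 'd::finite, 'n::finite) control_data \<Rightarrow> real \<Rightarrow> real \<Rightarrow> bool" where
  "assumption_A_driver D C \<mu> \<longleftrightarrow>
     (let T = horizon D; A = controls D; f = driver D in
     continuous_on (A \<times> {0..T} \<times> UNIV) (\<lambda>(\<alpha>, t, x, y, z, k). f \<alpha> t x y z k) \<and>
     (\<forall>\<alpha>\<in>A. \<forall>t\<in>{0..T}. \<forall>x. \<bar>f \<alpha> t x 0 0 0\<bar> \<le> C) \<and>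
     (\<forall>\<alpha>\<in>A. \<forall>t\<in>{0..T}. \<forall>x y y' z k.
        (y - y') * (f \<alpha> t x y z k - f \<alpha> t x y' z k) \<le> \<mu> * \<bar>y - y'\<bar>\<^sup>2) \<and>
     (\<exists>\<phi>. continuous_on {0..} \<phi> \<and> mono_on {0..} \<phi> \<and> (\<forall>s\<ge>0. \<phi> s \<ge> 0) \<and>
        (\<forall>\<alpha>\<in>A. \<forall>t\<in>{0..T}. \<forall>x y z k.
           \<bar>f \<alpha> t x y z k\<bar> \<le> \<bar>f \<alpha> t x 0 0 0\<bar> + \<phi> \<bar>y\<bar> + C * (norm z + \<bar>k\<bar>))) \<and>
     (\<forall>\<alpha>\<in>A. \<forall>t\<in>{0..T}. \<forall>x y z. mono (\<lambda>k. f \<alpha> t x y z k)) \<and>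
     (\<forall>\<alpha>\<in>A. \<forall>t\<in>{0..T}. \<forall>x x' y z z' k k'.
        \<bar>f \<alpha> t x y z k - f \<alpha> t x' y z' k'\<bar> \<le> C * (norm (x - x') + norm (z - z') + \<bar>k - k'\<bar>)))"

text \<open>
  The last conjunct, measurability of \<open>e \<mapsto> \<eta>\<^sup>\<alpha>(t,x,e)\<close>, is what makes the integrals of the jump
  coefficient against \<open>\<nu>\<close> meaningful; the Bochner integral of a non-measurable function is \<open>0\<close>.
\<close>

definition assumption_A :: "('a::metric_space, 'd::finite, 'n::finite) control_data \<Rightarrow> bool" where
  "assumption_A D \<longleftrightarrow>
     compact (controls D) \<and>
     (\<exists>C>0. \<exists>\<mu>. assumption_A_coeffs D C \<and> assumption_A_driver D C \<mu>) \<and>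
     (\<exists>L. L-lipschitz_on UNIV (mfun D)) \<and> mono (mfun D) \<and> mfun D 0 = 0 \<and>
     (\<forall>\<alpha>\<in>controls D. \<forall>t\<in>{0..horizon D}. \<forall>x. jumps D \<alpha> t x \<in> borel_measurable (levy D))"

text \<open>
  The function \<open>\<partial>\<^sup>o\<^sub>yf\<close> is not determined by \<open>f\<close>, so it is a parameter \<open>df\<close>; \<open>\<mu>\<close> is its upper bound.
\<close>

definition assumption_S ::
  "('a::metric_space, 'd::finite, 'n::finite) control_data \<Rightarrow>
   ('a \<Rightarrow> real \<Rightarrow> real^'d \<Rightarrow> real \<Rightarrow> real^'d \<Rightarrow> real \<Rightarrow> real) \<Rightarrow> real \<Rightarrow> bool" where
  "assumption_S D df \<mu> \<longleftrightarrow>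
     (let T = horizon D; A = controls D; f = driver D in
     (\<forall>\<alpha>\<in>A. \<forall>t\<in>{0..T}. \<forall>x y z k. df \<alpha> t x y z k \<le> \<mu>) \<and>
     (\<forall>t\<in>{0..T}. \<forall>x y. \<forall>\<K>. compact \<K> \<and> \<K> \<subseteq> A \<times> UNIV \<times> UNIV \<longrightarrow>
        (\<exists>U C. open U \<and> y \<in> U \<and> C > 0 \<and>
           (\<forall>p\<in>\<K>. \<forall>\<epsilon>>0. \<exists>\<delta>>0. \<forall>v\<in>U. \<forall>q\<in>\<K>. dist q p < \<delta> \<longrightarrow>
              dist (case q of (\<alpha>, z, k) \<Rightarrow> df \<alpha> t x v z k)
                   (case p of (\<alpha>, z, k) \<Rightarrow> df \<alpha> t x v z k) < \<epsilon>) \<and>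
           (\<forall>v\<in>U. \<forall>(\<alpha>, z, k)\<in>\<K>. \<bar>df \<alpha> t x v z k\<bar> \<le> C) \<and>
           uniform_limit \<K>
             (\<lambda>s (\<alpha>, z, k). (f \<alpha> t x (y + s) z k - f \<alpha> t x y z k - df \<alpha> t x (y + s) z k * s) / s)
             (\<lambda>_. 0) (at 0))))"


section \<open>The discrete problem\<close>

text \<open>
  \<open>disc_A\<close>, \<open>disc_K\<close>, \<open>disc_B\<close> are the discrete operators for the given truncation size \<open>r\<close>, mesh size
  \<open>h\<close> and time \<open>t\<^sub>n\<close>; only the structural properties in \<open>valid_scheme\<close> are required of them.
  \<open>u_ext\<close> is the grid function \<open>u\<^sup>n\<close> together with its (arbitrary) values at neighbouring points
  outside the grid, which the central differences at boundary nodes refer to.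
  \<open>viscosity i\<close> is the Lax--Friedrichs term \<open>d\<^sub>i\<close>; it may depend on every other field.
\<close>

record ('a, 'd::finite, 'm::finite) scheme_data =
  trunc :: real                                        \<comment> \<open>\<open>r\<close>\<close>
  mesh :: real                                         \<comment> \<open>\<open>h\<close>\<close>
  tstep :: real                                        \<comment> \<open>\<open>\<Delta>t\<close>\<close>
  tn :: real                                           \<comment> \<open>\<open>t\<^sub>n\<close>\<close>
  node :: "'m \<Rightarrow> real^'d"                              \<comment> \<open>\<open>x\<^sub>i\<close>\<close>
  un :: "real^'m"                                      \<comment> \<open>\<open>u\<^sup>n\<close>\<close>
  u_ext :: "real^'d \<Rightarrow> real"
  disc_A :: "'a \<Rightarrow> real^'m^'m"
  disc_K :: "'a \<Rightarrow> real^'m \<Rightarrow> real^'m"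
  disc_B :: "'a \<Rightarrow> real^'m \<Rightarrow> real^'m"
  viscosity :: "'m \<Rightarrow> real"

definition central_diff :: "('a, 'd::finite, 'm::finite) scheme_data \<Rightarrow> 'm \<Rightarrow> real^'d" where
  "central_diff S i =
     (\<chi> j. u_ext S (node S i + mesh S *\<^sub>R axis j 1) - u_ext S (node S i - mesh S *\<^sub>R axis j 1))"

definition vol_trunc :: "('a, 'd::finite, 'n::finite) control_data \<Rightarrow> real \<Rightarrow> 'a \<Rightarrow> real \<Rightarrow> real^'d \<Rightarrow> real^'d^'d" where
  "vol_trunc D r \<alpha> t x = (\<chi> i j. if i = j
      then sqrt ((vol D \<alpha> t x $ j $ j)\<^sup>2 + (LINT e:{e. e \<noteq> 0 \<and> norm e < r}|levy D. \<bar>jumps D \<alpha> t x e $ j\<bar>\<^sup>2))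
      else vol D \<alpha> t x $ i $ j)"

definition z_arg ::
  "('a, 'd::finite, 'n::finite) control_data \<Rightarrow> ('a, 'd, 'm::finite) scheme_data \<Rightarrow> 'a \<Rightarrow> 'm \<Rightarrow> real^'d \<Rightarrow> real^'d" where
  "z_arg D S \<alpha> i w =
     (1 / (2 * mesh S)) *\<^sub>R (transpose (vol_trunc D (trunc S) \<alpha> (tn S) (node S i)) *v w)"

definition f_bar ::
  "('a, 'd::finite, 'n::finite) control_data \<Rightarrow> ('a, 'd, 'm::finite) scheme_data \<Rightarrow>
   'a \<Rightarrow> 'm \<Rightarrow> real \<Rightarrow> real^'d \<Rightarrow> real \<Rightarrow> real" where
  "f_bar D S \<alpha> i y w k = driver D \<alpha> (tn S) (node S i) y (z_arg D S \<alpha> i w) k + viscosity S i"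

definition f_tilde ::
  "('a, 'd::finite, 'n::finite) control_data \<Rightarrow> ('a, 'd, 'm::finite) scheme_data \<Rightarrow>
   'a \<Rightarrow> 'm \<Rightarrow> real \<Rightarrow> real^'d \<Rightarrow> real \<Rightarrow> real" where
  "f_tilde D S \<alpha> i y w k =
     f_bar D S \<alpha> i y w k + penalty D * max (obstacle D (tn S) (node S i) - y) 0"

definition valid_scheme ::
  "('a::metric_space, 'd::finite, 'n::finite) control_data \<Rightarrow> ('a, 'd, 'm::finite) scheme_data \<Rightarrow> bool" where
  "valid_scheme D S \<longleftrightarrow>
     mesh S > 0 \<and> tstep S > 0 \<and> tn S \<in> {0..horizon D} \<and>
     inj (node S) \<and> (\<forall>i j l. (node S i $ l - node S j $ l) / mesh S \<in> \<int>) \<and>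
     (\<forall>i. u_ext S (node S i) = un S $ i) \<and>
     continuous_on (controls D) (disc_A S) \<and>
     (\<forall>v. continuous_on (controls D) (\<lambda>\<alpha>. disc_K S \<alpha> v)) \<and>
     (\<forall>v. continuous_on (controls D) (\<lambda>\<alpha>. disc_B S \<alpha> v)) \<and>
     (\<forall>\<alpha>\<in>controls D.
        (\<forall>i. (- disc_A S \<alpha>) $ i $ i > 0) \<and>
        (\<forall>i j. i \<noteq> j \<longrightarrow> (- disc_A S \<alpha>) $ i $ j \<le> 0) \<and>
        (\<forall>i. (\<Sum>j\<in>UNIV. (- disc_A S \<alpha>) $ i $ j) \<ge> 0)) \<and>
     (\<forall>i y k. continuous_on (controls D) (\<lambda>\<alpha>. f_bar D S \<alpha> i y (central_diff S i) k))"

definition G_ctrl ::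
  "('a, 'd::finite, 'n::finite) control_data \<Rightarrow> ('a, 'd, 'm::finite) scheme_data \<Rightarrow> 'a \<Rightarrow> real^'m \<Rightarrow> real^'m" where
  "G_ctrl D S \<alpha> u = (\<chi> i. u $ i - un S $ i - tstep S *
     ((disc_A S \<alpha> *v u) $ i + disc_K S \<alpha> (un S) $ i
      + f_tilde D S \<alpha> i (u $ i) (central_diff S i) (disc_B S \<alpha> (un S) $ i)))"

definition G_inf ::
  "('a, 'd::finite, 'n::finite) control_data \<Rightarrow> ('a, 'd, 'm::finite) scheme_data \<Rightarrow> real^'m \<Rightarrow> real^'m" where
  "G_inf D S u = (\<chi> i. INF \<alpha>\<in>controls D. G_ctrl D S \<alpha> u $ i)"

definition P_mat ::
  "('a, 'd::finite, 'n::finite) control_data \<Rightarrow> ('a, 'd, 'm::finite) scheme_data \<Rightarrow>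
   ('a \<Rightarrow> real \<Rightarrow> real^'d \<Rightarrow> real \<Rightarrow> real^'d \<Rightarrow> real \<Rightarrow> real) \<Rightarrow> ('m \<Rightarrow> 'a) \<Rightarrow> real^'m \<Rightarrow> real^'m^'m" where
  "P_mat D S df \<alpha> u = (\<chi> i j. if i = j
      then df (\<alpha> i) (tn S) (node S i) (u $ i) (z_arg D S (\<alpha> i) i (central_diff S i))
             (disc_B S (\<alpha> i) (un S) $ i)
      else 0)"

definition V_mat ::
  "('a, 'd::finite, 'n::finite) control_data \<Rightarrow> ('a, 'd, 'm::finite) scheme_data \<Rightarrow> real^'m \<Rightarrow> real^'m^'m" where
  "V_mat D S u = (\<chi> i j. if i = j
      then - penalty D * of_bool (obstacle D (tn S) (node S i) - u $ i > 0)
      else 0)"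

definition L_mat ::
  "('a, 'd::finite, 'n::finite) control_data \<Rightarrow> ('a, 'd, 'm::finite) scheme_data \<Rightarrow>
   ('a \<Rightarrow> real \<Rightarrow> real^'d \<Rightarrow> real \<Rightarrow> real^'d \<Rightarrow> real \<Rightarrow> real) \<Rightarrow> ('m \<Rightarrow> 'a) \<Rightarrow> real^'m \<Rightarrow> real^'m^'m" where
  "L_mat D S df \<alpha> u = (\<chi> i.
     (mat 1 - tstep S *\<^sub>R disc_A S (\<alpha> i)) $ i - tstep S *\<^sub>R (P_mat D S df \<alpha> u $ i + V_mat D S u $ i))"

definition policy_iteration ::
  "('a, 'd::finite, 'n::finite) control_data \<Rightarrow> ('a, 'd, 'm::finite) scheme_data \<Rightarrow>
   ('a \<Rightarrow> real \<Rightarrow> real^'d \<Rightarrow> real \<Rightarrow> real^'d \<Rightarrow> real \<Rightarrow> real) \<Rightarrow>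
   (nat \<Rightarrow> 'm \<Rightarrow> 'a) \<Rightarrow> (nat \<Rightarrow> real^'m) \<Rightarrow> bool" where
  "policy_iteration D S df \<alpha> u \<longleftrightarrow> (\<forall>k.
     (\<forall>i. is_arg_min (\<lambda>a. G_ctrl D S a (u k) $ i) (\<lambda>a. a \<in> controls D) (\<alpha> (Suc k) i)) \<and>
     G_inf D S (u k) + L_mat D S df (\<alpha> (Suc k)) (u k) *v (u (Suc k) - u k) = 0)"

end

theory Submission
  imports Defs
begin

text \<open>
  Row by row, \<open>\<L>\<^sup>\<alpha>[u]\<close> is \<open>I - \<Delta>t A\<close>, which has nonpositive off-diagonal entries and row sums at
  least \<open>1\<close>, plus a diagonal that lowers the row sum by at most \<open>\<mu> \<Delta>t\<close>: the penalty only helps, and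
  \<open>\<partial>\<^sup>o\<^sub>yf \<le> \<mu>\<close>. So the row sums are at least \<open>c\<^sub>0\<close>. Evaluating \<open>\<L>v\<close> at a node where \<open>\<bar>v\<^sub>i\<bar>\<close> is largest
  gives \<open>\<bar>\<L>v\<bar>\<^sub>0 \<ge> c\<^sub>0 \<bar>v\<bar>\<^sub>0\<close> (\<open>L_mat_infnorm_ge\<close>), which is both nonsingularity and the bound on the
  inverse, uniformly in \<open>\<alpha>\<close> and \<open>u\<close>.

  Policy iteration is Newton's method for \<open>\<G>\<close>, with \<open>\<L>\<^sup>\<alpha>[u]\<close> in the role of the derivative. If
  \<open>\<G>[u\<^sup>*] = 0\<close>, one step from \<open>v\<close> to \<open>w\<close> satisfies
  \<open>\<L>(w - u\<^sup>*) = - (\<G>[v] - \<G>[u\<^sup>*] - \<L>(v - u\<^sup>*))\<close>, with \<open>\<L> = \<L>\<^sup>\<alpha>[v]\<close> for the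
  minimizing policy \<open>\<alpha>\<close> of that step. By the uniform bound on the inverse, superlinear convergence follows once the
  right-hand side is \<open>o(\<bar>v - u\<^sup>*\<bar>)\<close>, uniformly over the minimizing policies at \<open>v\<close>
  (\<open>G_inf_newton\<close>).

  That estimate has two ingredients. For a fixed control, \<open>\<G>\<^sup>\<alpha>\<close> has the required expansion
  uniformly in \<open>\<alpha>\<close>: the limit in Assumption S handles \<open>f\<close>, and the penalty term is piecewise linear,
  so its expansion is exact near \<open>u\<^sup>*\<close> (\<open>G_ctrl_newton\<close>). The infimum over \<open>\<alpha>\<close> is then treated by a
  Danskin-type argument (\<open>newton_derivative_INF\<close>): a minimizer at \<open>v\<close> gives a lower bound for
  \<open>\<G>[v] - \<G>[u\<^sup>*]\<close>, a minimizer at \<open>u\<^sup>*\<close> an upper bound, and the two bounds have nearly the same slope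
  because minimizers at points near \<open>u\<^sup>*\<close> accumulate only at minimizers at \<open>u\<^sup>*\<close>. Comparing the slopes
  needs the rows of \<open>\<L>\<close> to vary continuously with the control, uniformly in \<open>u\<close> near \<open>u\<^sup>*\<close>
  (\<open>L_row_equicontinuous\<close>). Assumption S provides this as soon as the arguments at which
  \<open>\<partial>\<^sup>o\<^sub>yf\<close> is evaluated are continuous in \<open>\<alpha>\<close>; for the truncated volatility that is dominated convergence
  against the Levy measure (\<open>continuous_on_truncated_jumps\<close>).
\<close>

section \<open>Row diagonally dominant matrices\<close>

lemma infnorm_attained:
  fixes v :: "real^'m"
  obtains i where "infnorm v = \<bar>v $ i\<bar>"
proof -
  have "{\<bar>v $ i\<bar> |i. i \<in> UNIV} = range (\<lambda>i. \<bar>v $ i\<bar>)" by auto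
  then have "infnorm v = Max (range (\<lambda>i. \<bar>v $ i\<bar>))"
    by (simp add: infnorm_cart cSup_eq_Max)
  moreover have "Max (range (\<lambda>i. \<bar>v $ i\<bar>)) \<in> range (\<lambda>i. \<bar>v $ i\<bar>)"
    by (rule Max_in) auto
  ultimately have "infnorm v \<in> range (\<lambda>i. \<bar>v $ i\<bar>)" by simp
  then show ?thesis using that by blast
qed

lemma infnorm_leI:
  fixes v :: "real^'m"
  assumes "\<And>i. \<bar>v $ i\<bar> \<le> c"
  shows "infnorm v \<le> c"
  using assms by (metis infnorm_attained)

text \<open>
  At an index \<open>i\<close> where \<open>\<bar>v\<^sub>i\<bar>\<close> is largest, replacing every other \<open>v\<^sub>j\<close> by \<open>v\<^sub>i\<close> can only decrease
  \<open>(Qv)\<^sub>i\<close> in the direction of the sign of \<open>v\<^sub>i\<close>, because the off-diagonal weights are nonpositive.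
  After the replacement, the value is the row sum times \<open>\<bar>v\<^sub>i\<bar>\<close>.
\<close>
lemma infnorm_mult_vec_ge:
  fixes Q :: "real^'m^'m"
  assumes off: "\<And>i j. i \<noteq> j \<Longrightarrow> Q $ i $ j \<le> 0"
    and row: "\<And>i. (\<Sum>j\<in>UNIV. Q $ i $ j) \<ge> c"
  shows "c * infnorm v \<le> infnorm (Q *v v)"
proof -
  obtain i where i: "infnorm v = \<bar>v $ i\<bar>" by (rule infnorm_attained)
  define s where "s = (if v $ i \<ge> 0 then 1 else - 1 :: real)"
  have s: "\<bar>s\<bar> = 1" "s * v $ i = \<bar>v $ i\<bar>" by (auto simp: s_def)
  have le: "Q $ i $ j * \<bar>v $ i\<bar> \<le> s * (Q $ i $ j * v $ j)" for j
  proof (cases "j = i")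
    case True
    then show ?thesis using s(2) by (simp add: mult.left_commute[of s])
  next
    case False
    have "s * v $ j \<le> \<bar>s * v $ j\<bar>" by simp
    also have "\<dots> = \<bar>v $ j\<bar>" using s(1) by (simp add: abs_mult)
    also have "\<dots> \<le> \<bar>v $ i\<bar>" using component_le_infnorm_cart[of v j] i by simp
    finally have "Q $ i $ j * \<bar>v $ i\<bar> \<le> Q $ i $ j * (s * v $ j)"
      using off[of i j] False by (intro mult_left_mono_neg) auto
    then show ?thesis by (simp add: algebra_simps)
  qed
  have "c * infnorm v \<le> (\<Sum>j\<in>UNIV. Q $ i $ j) * \<bar>v $ i\<bar>"
    unfolding i by (intro mult_right_mono row) auto
  also have "\<dots> = (\<Sum>j\<in>UNIV. Q $ i $ j * \<bar>v $ i\<bar>)" by (simp add: sum_distrib_right)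
  also have "\<dots> \<le> (\<Sum>j\<in>UNIV. s * (Q $ i $ j * v $ j))" by (intro sum_mono le)
  also have "\<dots> = s * (Q *v v) $ i"
    by (simp add: matrix_vector_mult_def sum_distrib_left)
  also have "\<dots> \<le> \<bar>s * (Q *v v) $ i\<bar>" by simp
  also have "\<dots> = \<bar>(Q *v v) $ i\<bar>" using s(1) by (simp add: abs_mult)
  also have "\<dots> \<le> infnorm (Q *v v)" by (rule component_le_infnorm_cart)
  finally show ?thesis .
qed

lemma invertible_matrix_norm0_inv_le:
  fixes Q :: "real^'m^'m"
  assumes lower: "\<And>v. c * infnorm v \<le> infnorm (Q *v v)" and c: "c > 0"
  shows "invertible Q" "matrix_norm0 (matrix_inv Q) \<le> 1 / c"
proof -
  have "x = 0" if "Q *v x = 0" for x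
  proof -
    have "c * infnorm x \<le> 0" using lower[of x] that by (simp add: infnorm_0)
    then have "infnorm x \<le> 0" using c by (simp add: mult_le_0_iff)
    then show ?thesis using infnorm_eq_0[of x] infnorm_pos_le[of x] by simp
  qed
  then show inv: "invertible Q"
    unfolding invertible_left_inverse matrix_left_invertible_ker by blast
  have Qinv: "Q *v (matrix_inv Q *v v) = v" for v
    using someI_ex[OF inv[unfolded invertible_def]]
    by (simp add: matrix_inv_def matrix_vector_mul_assoc)
  show "matrix_norm0 (matrix_inv Q) \<le> 1 / c"
    unfolding matrix_norm0_def
  proof (rule cSUP_least)
    show "{v::real^'m. infnorm v \<le> 1} \<noteq> {}"
      by (auto intro!: exI[of _ 0] simp: infnorm_0)
  next
    fix v :: "real^'m" assume "v \<in> {v. infnorm v \<le> 1}"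
    then have "c * infnorm (matrix_inv Q *v v) \<le> 1"
      using lower[of "matrix_inv Q *v v"] Qinv[of v] by auto
    then show "infnorm (matrix_inv Q *v v) \<le> 1 / c"
      using c by (simp add: field_simps)
  qed
qed

section \<open>Newton derivatives of infima and superlinear convergence\<close>

lemma INF_eq_is_arg_min:
  fixes H :: "'a \<Rightarrow> real"
  assumes "is_arg_min H (\<lambda>a. a \<in> A) p"
  shows "(INF a\<in>A. H a) = H p"
  using assms by (intro cInf_eq_minimum) (auto simp: is_arg_min_def not_less)

text \<open>
  Here \<open>\<Lambda> a u\<close> is a Newton (slanting) derivative of \<open>H a\<close> at \<open>us\<close>: the slope is taken at the moving
  point \<open>u\<close>, not at \<open>us\<close>. The conclusion is that the slope belonging to any minimizer at \<open>u\<close> is one for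
  the infimum. Along a violating sequence \<open>u\<^sub>n \<rightarrow> us\<close> the minimizers \<open>a\<^sub>n\<close> subconverge, by compactness, to
  some \<open>p\<close>, and \<open>p\<close> minimizes at \<open>us\<close> by continuity. Using \<open>a\<^sub>n\<close> as a competitor at \<open>us\<close> bounds the
  increment of the infimum from below, using \<open>p\<close> as a competitor at \<open>u\<^sub>n\<close> bounds it from above, and
  equicontinuity at \<open>p\<close> makes the two slopes agree up to \<open>\<epsilon>\<close>.
\<close>
lemma newton_derivative_INF:
  fixes H :: "'a::metric_space \<Rightarrow> 'b::real_inner \<Rightarrow> real" and \<Lambda> :: "'a \<Rightarrow> 'b \<Rightarrow> 'b"
  assumes A: "compact A"
    and cont: "continuous_on (A \<times> UNIV) (\<lambda>(a, u). H a u)"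
    and newton: "\<And>\<epsilon>. \<epsilon> > 0 \<Longrightarrow> \<exists>\<delta>>0. \<forall>a\<in>A. \<forall>u. norm (u - us) < \<delta> \<longrightarrow>
      \<bar>H a u - H a us - \<Lambda> a u \<bullet> (u - us)\<bar> \<le> \<epsilon> * norm (u - us)"
    and equi: "\<And>p \<epsilon>. p \<in> A \<Longrightarrow> \<epsilon> > 0 \<Longrightarrow> \<exists>\<delta>>0. \<forall>a\<in>A. \<forall>u. dist a p < \<delta> \<longrightarrow> norm (u - us) < \<delta> \<longrightarrow>
      norm (\<Lambda> a u - \<Lambda> p u) \<le> \<epsilon>"
    and \<epsilon>: "\<epsilon> > 0"
  shows "\<exists>\<delta>>0. \<forall>u a. norm (u - us) < \<delta> \<longrightarrow> is_arg_min (\<lambda>a. H a u) (\<lambda>a. a \<in> A) a \<longrightarrow>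
    \<bar>(INF a\<in>A. H a u) - (INF a\<in>A. H a us) - \<Lambda> a u \<bullet> (u - us)\<bar> \<le> \<epsilon> * norm (u - us)"
proof (rule ccontr)
  assume contra: "\<not> ?thesis"
  have "\<exists>u a. norm (u - us) < inverse (real (Suc n)) \<and> is_arg_min (\<lambda>a. H a u) (\<lambda>a. a \<in> A) a \<and>
      \<not> \<bar>(INF a\<in>A. H a u) - (INF a\<in>A. H a us) - \<Lambda> a u \<bullet> (u - us)\<bar> \<le> \<epsilon> * norm (u - us)" for n
  proof -
    have "inverse (real (Suc n)) > 0" by simp
    with contra show ?thesis by blast
  qed
  then obtain u a where u: "\<And>n. norm (u n - us) < inverse (real (Suc n))"
    and a: "\<And>n. is_arg_min (\<lambda>a. H a (u n)) (\<lambda>a. a \<in> A) (a n)"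
    and bad: "\<And>n. \<not> \<bar>(INF a\<in>A. H a (u n)) - (INF a\<in>A. H a us) - \<Lambda> (a n) (u n) \<bullet> (u n - us)\<bar>
      \<le> \<epsilon> * norm (u n - us)"
    by metis
  have aA: "a n \<in> A" for n using a[of n] by (simp add: is_arg_min_def)
  obtain p r where p: "p \<in> A" and r: "strict_mono (r :: nat \<Rightarrow> nat)" and ap: "(a \<circ> r) \<longlonglongrightarrow> p"
    using A aA unfolding compact_def by blast
  have "(\<lambda>n. u n - us) \<longlonglongrightarrow> 0"
    by (rule Lim_null_comparison[OF _ LIMSEQ_inverse_real_of_nat]) (intro always_eventually allI less_imp_le u)
  then have "u \<longlonglongrightarrow> us" by (simp add: LIM_zero_iff)
  then have ur: "(u \<circ> r) \<longlonglongrightarrow> us" using r by (rule LIMSEQ_subseq_LIMSEQ)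
  have lim: "(\<lambda>n. H (b n) (u (r n))) \<longlonglongrightarrow> H q us"
    if "\<And>n. b n \<in> A" "b \<longlonglongrightarrow> q" "q \<in> A" for b q
  proof -
    have "(\<lambda>n. (b n, u (r n))) \<longlonglongrightarrow> (q, us)"
      using that(2) ur by (intro tendsto_Pair) (auto simp: o_def)
    from continuous_on_tendsto_compose[OF cont this] that show ?thesis by auto
  qed
  have pmin: "is_arg_min (\<lambda>a. H a us) (\<lambda>a. a \<in> A) p"
  proof -
    have "H p us \<le> H b us" if "b \<in> A" for b
    proof (rule LIMSEQ_le)
      show "(\<lambda>n. H (a (r n)) (u (r n))) \<longlonglongrightarrow> H p us"
        using lim[of "\<lambda>n. a (r n)" p] aA ap p by (auto simp: o_def)
      show "(\<lambda>n. H b (u (r n))) \<longlonglongrightarrow> H b us"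
        using lim[of "\<lambda>n. b" b] that by auto
      show "\<exists>N. \<forall>n\<ge>N. H (a (r n)) (u (r n)) \<le> H b (u (r n))"
        using a that by (auto simp: is_arg_min_def not_less)
    qed
    then show ?thesis using p by (auto simp: is_arg_min_def not_less)
  qed
  obtain \<delta>1 where \<delta>1: "\<delta>1 > 0" and new: "\<And>a u. a \<in> A \<Longrightarrow> norm (u - us) < \<delta>1 \<Longrightarrow>
      \<bar>H a u - H a us - \<Lambda> a u \<bullet> (u - us)\<bar> \<le> \<epsilon> / 2 * norm (u - us)"
    using newton[of "\<epsilon> / 2"] \<epsilon> by auto
  obtain \<delta>2 where \<delta>2: "\<delta>2 > 0" and eq: "\<And>a u. a \<in> A \<Longrightarrow> dist a p < \<delta>2 \<Longrightarrow>
      norm (u - us) < \<delta>2 \<Longrightarrow> norm (\<Lambda> a u - \<Lambda> p u) \<le> \<epsilon> / 2"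
    using equi[OF p, of "\<epsilon> / 2"] \<epsilon> by auto
  have "\<forall>\<^sub>F n in sequentially. dist (u (r n)) us < min \<delta>1 \<delta>2"
    using tendstoD[OF ur, of "min \<delta>1 \<delta>2"] \<delta>1 \<delta>2 by (simp add: o_def)
  moreover have "\<forall>\<^sub>F n in sequentially. dist (a (r n)) p < \<delta>2"
    using tendstoD[OF ap \<delta>2] by (simp add: o_def)
  ultimately have "\<forall>\<^sub>F n in sequentially. dist (u (r n)) us < min \<delta>1 \<delta>2 \<and> dist (a (r n)) p < \<delta>2"
    by (rule eventually_conj)
  then obtain n where un: "dist (u (r n)) us < min \<delta>1 \<delta>2" and an: "dist (a (r n)) p < \<delta>2"
    by (auto dest: eventually_happens)
  define U where "U = u (r n)"
  define \<alpha> where "\<alpha> = a (r n)"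
  define w where "w = U - us"
  have w1: "norm w < \<delta>1" and w2: "norm w < \<delta>2" using un by (auto simp: w_def U_def dist_norm)
  have \<alpha>A: "\<alpha> \<in> A" and \<alpha>p: "dist \<alpha> p < \<delta>2" using aA an by (auto simp: \<alpha>_def)
  have I1: "(INF a\<in>A. H a U) = H \<alpha> U" unfolding U_def \<alpha>_def by (rule INF_eq_is_arg_min[OF a])
  have I2: "(INF a\<in>A. H a us) = H p us" by (rule INF_eq_is_arg_min[OF pmin])
  have c1: "H \<alpha> U \<le> H p U" using a[of "r n"] p by (auto simp: is_arg_min_def not_less U_def \<alpha>_def)
  have c2: "H p us \<le> H \<alpha> us" using pmin \<alpha>A by (auto simp: is_arg_min_def not_less)
  have n1: "\<bar>H \<alpha> U - H \<alpha> us - \<Lambda> \<alpha> U \<bullet> w\<bar> \<le> \<epsilon> / 2 * norm w"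
    using new[OF \<alpha>A, of U] w1 by (simp add: w_def)
  have n2: "\<bar>H p U - H p us - \<Lambda> p U \<bullet> w\<bar> \<le> \<epsilon> / 2 * norm w"
    using new[OF p, of U] w1 by (simp add: w_def)
  have "\<bar>(\<Lambda> \<alpha> U - \<Lambda> p U) \<bullet> w\<bar> \<le> norm (\<Lambda> \<alpha> U - \<Lambda> p U) * norm w" by (rule Cauchy_Schwarz_ineq2)
  also have "\<dots> \<le> \<epsilon> / 2 * norm w"
    using eq[OF \<alpha>A \<alpha>p, of U] w2 by (intro mult_right_mono) (auto simp: w_def)
  finally have n3: "\<bar>\<Lambda> \<alpha> U \<bullet> w - \<Lambda> p U \<bullet> w\<bar> \<le> \<epsilon> / 2 * norm w" by (simp add: inner_diff_left)
  have e: "\<epsilon> * norm w = \<epsilon> / 2 * norm w + \<epsilon> / 2 * norm w" by simp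
  have nn: "0 \<le> \<epsilon> / 2 * norm w" using \<epsilon> by simp
  have "\<bar>H \<alpha> U - H p us - \<Lambda> \<alpha> U \<bullet> w\<bar> \<le> \<epsilon> * norm w"
    unfolding e using c1 c2 n1 n2 n3 nn by linarith
  then show False using bad[of "r n"] I1 I2 by (simp add: U_def \<alpha>_def w_def)
qed

text \<open>
  A one-step estimate with arbitrarily small factors gives factor \<open>1/2\<close> on some neighbourhood. Iterates
  that start there stay there and converge geometrically, so every smaller factor applies eventually.
  The iteration is a relation because the minimizing policy, and hence the next iterate, need not be
  unique.
\<close>
lemma locally_superlinear:
  fixes us :: "'b::euclidean_space"
  assumes step: "\<And>\<epsilon>. \<epsilon> > 0 \<Longrightarrow> \<exists>\<delta>>0. \<forall>v w. infnorm (v - us) < \<delta> \<longrightarrow> R v w \<longrightarrow>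
      infnorm (w - us) \<le> \<epsilon> * infnorm (v - us)"
  shows "\<exists>N. open N \<and> us \<in> N \<and> (\<forall>u. (\<forall>k. R (u k) (u (Suc k))) \<longrightarrow> u 0 \<in> N \<longrightarrow>
      u \<longlonglongrightarrow> us \<and> (\<lambda>k. infnorm (u (Suc k) - us)) \<in> o(\<lambda>k. infnorm (u k - us)))"
proof -
  obtain \<delta> where \<delta>: "\<delta> > 0" and half: "\<And>v w. infnorm (v - us) < \<delta> \<Longrightarrow> R v w \<Longrightarrow>
      infnorm (w - us) \<le> 1 / 2 * infnorm (v - us)"
    using step[of "1 / 2"] by auto
  have conv: "u \<longlonglongrightarrow> us \<and> (\<lambda>k. infnorm (u (Suc k) - us)) \<in> o(\<lambda>k. infnorm (u k - us))"
    if R: "\<forall>k. R (u k) (u (Suc k))" and u0: "u 0 \<in> ball us \<delta>" for u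
  proof -
    have start: "infnorm (u 0 - us) < \<delta>"
      using u0 infnorm_le_norm[of "u 0 - us"] by (simp add: dist_norm norm_minus_commute)
    have geom: "infnorm (u k - us) \<le> (1 / 2) ^ k * \<delta> \<and> infnorm (u k - us) < \<delta>" for k
    proof (induction k)
      case 0
      then show ?case using start by simp
    next
      case (Suc k)
      then have le: "infnorm (u (Suc k) - us) \<le> 1 / 2 * infnorm (u k - us)" using half R by blast
      then show ?case using Suc infnorm_pos_le[of "u k - us"] by auto
    qed
    have "(\<lambda>k. (1 / 2) ^ k * \<delta>) \<longlonglongrightarrow> 0 * \<delta>"
      by (intro tendsto_mult tendsto_const LIMSEQ_power_zero) auto
    then have "(\<lambda>k. (1 / 2) ^ k * \<delta>) \<longlonglongrightarrow> 0" by simp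
    then have inf0: "(\<lambda>k. infnorm (u k - us)) \<longlonglongrightarrow> 0"
      by (rule Lim_null_comparison[rotated])
        (use geom in \<open>auto simp: infnorm_pos_le\<close>)
    then have "(\<lambda>k. sqrt (real DIM('b)) * infnorm (u k - us)) \<longlonglongrightarrow> 0"
      by (rule tendsto_mult_right_zero)
    then have "(\<lambda>k. u k - us) \<longlonglongrightarrow> 0"
      by (rule Lim_null_comparison[rotated]) (intro always_eventually allI norm_le_infnorm)
    then have "u \<longlonglongrightarrow> us" by (simp add: LIM_zero_iff)
    moreover have "(\<lambda>k. infnorm (u (Suc k) - us)) \<in> o(\<lambda>k. infnorm (u k - us))"
    proof (rule landau_o.smallI)
      fix c :: real assume "c > 0"
      then obtain \<eta> where \<eta>: "\<eta> > 0" and c: "\<And>v w. infnorm (v - us) < \<eta> \<Longrightarrow> R v w \<Longrightarrow>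
          infnorm (w - us) \<le> c * infnorm (v - us)"
        using step by metis
      have "\<forall>\<^sub>F k in sequentially. infnorm (u k - us) < \<eta>"
        using order_tendstoD(2)[OF inf0 \<eta>] .
      then show "\<forall>\<^sub>F k in sequentially. norm (infnorm (u (Suc k) - us)) \<le> c * norm (infnorm (u k - us))"
        by eventually_elim (use c R in \<open>auto simp: infnorm_pos_le\<close>)
    qed
    ultimately show ?thesis by blast
  qed
  show ?thesis
    using \<delta> conv by (intro exI[of _ "ball us \<delta>"]) auto
qed

section \<open>The discrete scheme\<close>

lemma norm_le_norm0:
  assumes "norm0 T w \<le> ennreal c" "c \<ge> 0" "t \<in> {0..T}"
  shows "norm (w t x) \<le> c"
proof -
  have "ennreal (norm (w t x)) \<le> norm0 T w"
    unfolding norm0_def by (intro SUP_upper2[OF assms(3)] SUP_upper) simp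
  then show ?thesis using assms(1,2) by (metis ennreal_le_iff order_trans)
qed

text \<open>
  The bound that makes the squared jumps integrable against the Levy measure.
\<close>
lemma norm_jumps_le:
  assumes "assumption_A_coeffs D C" "C > 0" "a \<in> controls D" "t \<in> {0..horizon D}" "e \<noteq> 0"
  shows "norm (jumps D a t x e) \<le> C * min 1 (norm e)"
proof -
  have "norm0 (horizon D) (\<lambda>t x. jumps D a t x e)
      \<le> norm1 (horizon D) (\<lambda>t x. jumps D a t x e) + norm0 (horizon D) (\<lambda>t x. intensity D t x e)"
    by (simp add: norm1_def add.assoc)
  also have "\<dots> \<le> ennreal (C * min 1 (norm e))"
    using assms by (auto simp: assumption_A_coeffs_def Let_def)
  finally show ?thesis using assms(2,4) by (intro norm_le_norm0) auto
qed

lemma space_levy: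
  assumes "levy_measure \<nu>"
  shows "space \<nu> = - {0}"
  using assms sets_eq_imp_space_eq[of \<nu> "restrict_space borel (- {0})"]
  by (auto simp: levy_measure_def space_restrict_space)

lemma measurable_levy:
  assumes "levy_measure \<nu>" and "f \<in> borel_measurable borel"
  shows "f \<in> borel_measurable \<nu>"
proof -
  have "f \<in> borel_measurable (restrict_space borel (- {0}))"
    using assms(2) by (rule measurable_restrict_space1)
  then show ?thesis
    using assms(1) by (simp add: levy_measure_def cong: measurable_cong_sets)
qed

lemma integrable_levy_min:
  assumes "levy_measure \<nu>"
  shows "integrable \<nu> (\<lambda>e. min 1 ((norm e)\<^sup>2))"
proof (rule integrableI_nonneg)
  show "(\<lambda>e. min 1 ((norm e)\<^sup>2)) \<in> borel_measurable \<nu>"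
    by (rule measurable_levy[OF assms]) measurable
qed (use assms in \<open>auto simp: levy_measure_def\<close>)

text \<open>
  Dominated convergence: \<open>\<bar>\<eta>\<^sub>j\<bar>\<^sup>2 \<le> C\<^sup>2 (1 \<and> \<bar>e\<bar>\<^sup>2)\<close> for every control, and the right-hand side is integrable
  against a Levy measure.
\<close>
lemma continuous_on_truncated_jumps:
  fixes D :: "('a::metric_space, 'd::finite, 'n::finite) control_data"
  assumes levy: "levy_measure (levy D)" and A: "assumption_A D" and t: "t \<in> {0..horizon D}"
  shows "continuous_on (controls D)
    (\<lambda>a. LINT e:{e. e \<noteq> 0 \<and> norm e < r}|levy D. \<bar>jumps D a t x e $ j\<bar>\<^sup>2)"
  unfolding continuous_on_sequentially
proof (intro allI ballI impI)
  fix s :: "nat \<Rightarrow> 'a" and p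
  assume p: "p \<in> controls D" and s: "(\<forall>n. s n \<in> controls D) \<and> s \<longlonglongrightarrow> p"
  obtain C where C: "C > 0" "assumption_A_coeffs D C" using A by (auto simp: assumption_A_def)
  have meas: "jumps D a t x \<in> borel_measurable (levy D)" if "a \<in> controls D" for a
    using A t that by (auto simp: assumption_A_def)
  have "{e. e \<noteq> 0 \<and> norm e < r} = - {0 :: real^'n} \<inter> {e. norm e < r}" by auto
  moreover have "{e :: real^'n. norm e < r} \<in> sets borel" by (intro borel_open open_Collect_less) (auto intro: continuous_intros)
  ultimately have set: "{e. e \<noteq> 0 \<and> norm e < r} \<in> sets (levy D)"
    using levy by (auto simp: levy_measure_def sets_restrict_space)
  have jump_meas: "(\<lambda>e. indicator {e. e \<noteq> 0 \<and> norm e < r} e *\<^sub>R \<bar>jumps D a t x e $ j\<bar>\<^sup>2) \<in> borel_measurable (levy D)"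
    if "a \<in> controls D" for a
  proof -
    have "(\<lambda>e. jumps D a t x e $ j) \<in> borel_measurable (levy D)"
      using measurable_compose[OF meas[OF that], of "\<lambda>v. v $ j" borel] by simp
    then show ?thesis using set by measurable
  qed
  have "(\<lambda>n. LINT e:{e. e \<noteq> 0 \<and> norm e < r}|levy D. \<bar>jumps D (s n) t x e $ j\<bar>\<^sup>2)
    \<longlonglongrightarrow> (LINT e:{e. e \<noteq> 0 \<and> norm e < r}|levy D. \<bar>jumps D p t x e $ j\<bar>\<^sup>2)"
    unfolding set_lebesgue_integral_def
  proof (rule integral_dominated_convergence)
    show "integrable (levy D) (\<lambda>e. C\<^sup>2 * min 1 ((norm e)\<^sup>2))"
      using integrable_levy_min[OF levy] by simp
    show "AE e in levy D. (\<lambda>n. indicator {e. e \<noteq> 0 \<and> norm e < r} e *\<^sub>R \<bar>jumps D (s n) t x e $ j\<bar>\<^sup>2)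
        \<longlonglongrightarrow> indicator {e. e \<noteq> 0 \<and> norm e < r} e *\<^sub>R \<bar>jumps D p t x e $ j\<bar>\<^sup>2"
    proof (rule AE_I2)
      fix e assume "e \<in> space (levy D)"
      then have "e \<in> - {0}" by (simp add: space_levy[OF levy])
      then have cont: "continuous_on (controls D \<times> {0..horizon D}) (\<lambda>(a, t). jumps D a t x e)"
        using C(2) by (auto simp: assumption_A_coeffs_def Let_def)
      have "(\<lambda>n. (s n, t)) \<longlonglongrightarrow> (p, t)" using s by (intro tendsto_intros) auto
      from continuous_on_tendsto_compose[OF cont this]
      have "(\<lambda>n. jumps D (s n) t x e) \<longlonglongrightarrow> jumps D p t x e"
        using p s t by auto
      then show "(\<lambda>n. indicator {e. e \<noteq> 0 \<and> norm e < r} e *\<^sub>R \<bar>jumps D (s n) t x e $ j\<bar>\<^sup>2)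
        \<longlonglongrightarrow> indicator {e. e \<noteq> 0 \<and> norm e < r} e *\<^sub>R \<bar>jumps D p t x e $ j\<bar>\<^sup>2"
        by (intro tendsto_intros tendsto_rabs tendsto_power tendsto_vec_nth)
    qed
    show "AE e in levy D. norm (indicator {e. e \<noteq> 0 \<and> norm e < r} e *\<^sub>R \<bar>jumps D (s n) t x e $ j\<bar>\<^sup>2)
        \<le> C\<^sup>2 * min 1 ((norm e)\<^sup>2)" for n
    proof (rule AE_I2)
      fix e assume "e \<in> space (levy D)"
      then have e: "e \<noteq> 0" by (simp add: space_levy[OF levy])
      have "\<bar>jumps D (s n) t x e $ j\<bar> \<le> norm (jumps D (s n) t x e)" by (rule component_le_norm_cart)
      also have "\<dots> \<le> C * min 1 (norm e)"
        using norm_jumps_le[OF C(2,1) _ t e] s by auto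
      finally have "\<bar>jumps D (s n) t x e $ j\<bar>\<^sup>2 \<le> (C * min 1 (norm e))\<^sup>2"
        by (intro power_mono) auto
      also have "\<dots> = C\<^sup>2 * min 1 ((norm e)\<^sup>2)"
        using power_le_one[of "norm e" 2] one_le_power[of "norm e" 2]
        by (cases "norm e \<le> 1") (auto simp: power_mult_distrib min_def)
      finally show "norm (indicator {e. e \<noteq> 0 \<and> norm e < r} e *\<^sub>R \<bar>jumps D (s n) t x e $ j\<bar>\<^sup>2)
          \<le> C\<^sup>2 * min 1 ((norm e)\<^sup>2)"
        by (auto simp: indicator_def)
    qed
  qed (use jump_meas p s in auto)
  then show "((\<lambda>a. LINT e:{e. e \<noteq> 0 \<and> norm e < r}|levy D. \<bar>jumps D a t x e $ j\<bar>\<^sup>2) \<circ> s)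
      \<longlonglongrightarrow> (LINT e:{e. e \<noteq> 0 \<and> norm e < r}|levy D. \<bar>jumps D p t x e $ j\<bar>\<^sup>2)"
    by (simp add: o_def)
qed

lemma continuous_on_z_arg:
  assumes levy: "levy_measure (levy D)" and A: "assumption_A D" and S: "valid_scheme D S"
  shows "continuous_on (controls D) (\<lambda>a. z_arg D S a i w)"
proof -
  have t: "tn S \<in> {0..horizon D}" using S by (simp add: valid_scheme_def)
  have "continuous_on (controls D \<times> {0..horizon D}) (\<lambda>(a, t). vol D a t (node S i))"
    using A by (auto simp: assumption_A_def assumption_A_coeffs_def Let_def)
  from continuous_on_compose2[OF this, of "controls D" "\<lambda>a. (a, tn S)"] t
  have vol: "continuous_on (controls D) (\<lambda>a. vol D a (tn S) (node S i))"
    by (force intro!: continuous_intros)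
  have entries: "continuous_on (controls D) (\<lambda>a. vol_trunc D (trunc S) a (tn S) (node S i) $ k $ j)" for j k
    using continuous_on_truncated_jumps[OF levy A t] vol
    by (cases "k = j") (auto simp: vol_trunc_def intro!: continuous_intros)
  show ?thesis
    unfolding z_arg_def matrix_vector_mult_def transpose_def vec_lambda_beta
    by (intro continuous_on_scaleR continuous_on_const continuous_on_vec_lambda continuous_on_sum
        continuous_on_mult entries)
qed

lemma continuous_on_disc_B:
  assumes "valid_scheme D S"
  shows "continuous_on (controls D) (\<lambda>a. disc_B S a v $ i)"
  using assms by (auto simp: valid_scheme_def intro!: continuous_intros)

text \<open>
  Joint continuity in the control and the iterate is what lets minimizers at nearby points converge to
  minimizers.
\<close>
lemma continuous_on_G_ctrl:
  fixes D :: "('a::metric_space, 'd::finite, 'n::finite) control_data"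
    and S :: "('a, 'd, 'm::finite) scheme_data"
  assumes levy: "levy_measure (levy D)" and A: "assumption_A D" and S: "valid_scheme D S"
  shows "continuous_on (controls D \<times> UNIV) (\<lambda>(a, u). G_ctrl D S a u $ i)"
proof -
  let ?Q = "controls D \<times> (UNIV :: (real^'m) set)"
  have lift: "continuous_on ?Q (\<lambda>q. g (fst q))"
    if "continuous_on (controls D) g" for g :: "'a \<Rightarrow> 'b::topological_space"
    by (rule continuous_on_compose2[OF that]) (auto intro!: continuous_intros)
  have t: "tn S \<in> {0..horizon D}" using S by (simp add: valid_scheme_def)
  have driver: "continuous_on (controls D \<times> {0..horizon D} \<times> UNIV)
      (\<lambda>(a, t, x, y, z, k). driver D a t x y z k)"
    using A by (auto simp: assumption_A_def assumption_A_driver_def Let_def)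
  have f: "continuous_on ?Q (\<lambda>q. driver D (fst q) (tn S) (node S i) (snd q $ i)
      (z_arg D S (fst q) i (central_diff S i)) (disc_B S (fst q) (un S) $ i))"
  proof -
    have "continuous_on ?Q (\<lambda>q. (fst q, tn S, node S i, snd q $ i,
        z_arg D S (fst q) i (central_diff S i), disc_B S (fst q) (un S) $ i))"
      by (intro continuous_on_Pair continuous_on_const continuous_on_component continuous_on_fst
          continuous_on_snd continuous_on_id lift[OF continuous_on_z_arg[OF levy A S]]
          lift[OF continuous_on_disc_B[OF S]])
    from continuous_on_compose2[OF driver this] t show ?thesis by force
  qed
  have "continuous_on ?Q (\<lambda>q. disc_A S (fst q))"
    using S by (intro lift) (simp add: valid_scheme_def)
  moreover have "continuous_on ?Q (\<lambda>q. disc_K S (fst q) (un S))"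
    using S by (intro lift[of "\<lambda>a. disc_K S a (un S)"]) (simp add: valid_scheme_def)
  ultimately show ?thesis
    using f unfolding G_ctrl_def f_tilde_def f_bar_def matrix_vector_mult_def
    by (auto simp: case_prod_unfold intro!: continuous_intros)
qed

text \<open>
  The \<open>i\<close>-th row of \<open>\<L>\<^sup>\<alpha>[u]\<close> depends on the policy only through \<open>\<alpha>\<^sub>i\<close>. Feeding the constant policy \<open>a\<close>
  thus yields the row as a function of a single control, which is the slope of \<open>\<G>\<^sup>a[\<cdot>]\<^sub>i\<close>.
\<close>
definition L_row ::
  "('a, 'd::finite, 'n::finite) control_data \<Rightarrow> ('a, 'd, 'm::finite) scheme_data \<Rightarrow>
   ('a \<Rightarrow> real \<Rightarrow> real^'d \<Rightarrow> real \<Rightarrow> real^'d \<Rightarrow> real \<Rightarrow> real) \<Rightarrow> 'm \<Rightarrow> 'a \<Rightarrow> real^'m \<Rightarrow> real^'m" where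
  "L_row D S df i a u = L_mat D S df (\<lambda>_. a) u $ i"

abbreviation df_at where
  "df_at D S df i a y \<equiv> df a (tn S) (node S i) y (z_arg D S a i (central_diff S i)) (disc_B S a (un S) $ i)"

lemma L_mat_row: "L_mat D S df \<alpha> u $ i = L_row D S df i (\<alpha> i) u"
  by (simp add: L_row_def L_mat_def P_mat_def vec_eq_iff)

lemma L_row_nth:
  "L_row D S df i a u $ j = (if i = j then 1 - tstep S * (df_at D S df i a (u $ i)
      - penalty D * of_bool (obstacle D (tn S) (node S i) - u $ i > 0)) else 0) - tstep S * disc_A S a $ i $ j"
  by (simp add: L_row_def L_mat_def P_mat_def V_mat_def mat_def algebra_simps)

lemma L_row_inner:
  "L_row D S df i a u \<bullet> w = w $ i - tstep S * ((disc_A S a *v w) $ i + df_at D S df i a (u $ i) * w $ i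
      - penalty D * of_bool (obstacle D (tn S) (node S i) - u $ i > 0) * w $ i)"
proof -
  have "L_row D S df i a u \<bullet> w = (\<Sum>j\<in>UNIV. (if i = j then (1 - tstep S * (df_at D S df i a (u $ i)
      - penalty D * of_bool (obstacle D (tn S) (node S i) - u $ i > 0))) * w $ j else 0)
      - tstep S * (disc_A S a $ i $ j * w $ j))"
    unfolding inner_vec_def L_row_nth
    by (intro sum.cong refl) (simp add: algebra_simps)
  also have "\<dots> = (1 - tstep S * (df_at D S df i a (u $ i)
      - penalty D * of_bool (obstacle D (tn S) (node S i) - u $ i > 0))) * w $ i
      - tstep S * (disc_A S a *v w) $ i"
    by (simp add: sum_subtractf sum_distrib_left matrix_vector_mult_def)
  finally show ?thesis by (simp add: algebra_simps)
qed

text \<open>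
  The row sum is \<open>1\<close>, minus \<open>\<Delta>t\<close> times a nonpositive row sum of \<open>A\<close>, minus \<open>\<Delta>t\<close> times a diagonal
  correction that is at most \<open>\<mu>\<close> because the penalty enters it with a minus sign.
\<close>
lemma L_mat_infnorm_ge:
  assumes pen: "penalty D \<ge> 0" and dfS: "assumption_S D df \<mu>" and S: "valid_scheme D S"
    and c: "1 - \<mu> * tstep S \<ge> c" and \<alpha>: "\<And>i. \<alpha> i \<in> controls D"
  shows "c * infnorm v \<le> infnorm (L_mat D S df \<alpha> u *v v)"
proof (rule infnorm_mult_vec_ge)
  have tau: "tstep S > 0" using S by (simp add: valid_scheme_def)
  fix i
  have A: "(\<Sum>j\<in>UNIV. disc_A S (\<alpha> i) $ i $ j) \<le> 0"
    and off: "\<And>j. i \<noteq> j \<Longrightarrow> disc_A S (\<alpha> i) $ i $ j \<ge> 0"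
    using S \<alpha> by (auto simp: valid_scheme_def sum_negf)
  show "L_mat D S df \<alpha> u $ i $ j \<le> 0" if "i \<noteq> j" for j
    using off[OF that] that tau by (simp add: L_mat_row L_row_nth)
  have "df_at D S df i (\<alpha> i) (u $ i) \<le> \<mu>"
    using dfS S \<alpha> by (auto simp: assumption_S_def valid_scheme_def Let_def)
  moreover have "0 \<le> penalty D * of_bool (obstacle D (tn S) (node S i) - u $ i > 0)" using pen by simp
  ultimately have "tstep S * (df_at D S df i (\<alpha> i) (u $ i)
      - penalty D * of_bool (obstacle D (tn S) (node S i) - u $ i > 0)) \<le> tstep S * \<mu>"
    using tau by (intro mult_left_mono) auto
  moreover have "tstep S * (\<Sum>j\<in>UNIV. disc_A S (\<alpha> i) $ i $ j) \<le> 0"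
    using A tau by (simp add: mult_le_0_iff)
  ultimately show "c \<le> (\<Sum>j\<in>UNIV. L_mat D S df \<alpha> u $ i $ j)"
    using c by (simp add: L_mat_row L_row_nth sum_subtractf sum_distrib_left mult.commute)
qed

text \<open>
  Away from the kink the positive part is affine near \<open>y\<close>, and at the kink \<open>\<zeta> = y\<close> it is positively
  homogeneous in \<open>s\<close>. In both cases the one-sided slope at the moving point \<open>y + s\<close> reproduces the
  increment without error.
\<close>
lemma penalty_newton_exact:
  fixes \<zeta> y :: real
  shows "\<exists>\<delta>>0. \<forall>s. \<bar>s\<bar> < \<delta> \<longrightarrow> max (\<zeta> - (y + s)) 0 - max (\<zeta> - y) 0 + of_bool (\<zeta> - (y + s) > 0) * s = 0"
proof (cases "\<zeta> = y")
  case True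
  then show ?thesis by (intro exI[of _ 1]) auto
next
  case False
  then show ?thesis by (intro exI[of _ "\<bar>\<zeta> - y\<bar>"]) auto
qed

text \<open>
  Only the values \<open>(z, k)\<close> that a control produces from \<open>u\<^sup>n\<close> enter the scheme. Together with the
  controls they form the compact set to which Assumption S is applied.
\<close>
lemma compact_scheme_arguments:
  fixes D :: "('a::metric_space, 'd::finite, 'n::finite) control_data"
    and S :: "('a, 'd, 'm::finite) scheme_data"
  assumes levy: "levy_measure (levy D)" and A: "assumption_A D" and S: "valid_scheme D S"
  shows "continuous_on (controls D) (\<lambda>a. (a, z_arg D S a i (central_diff S i), disc_B S a (un S) $ i))"
    and "compact ((\<lambda>a. (a, z_arg D S a i (central_diff S i), disc_B S a (un S) $ i)) ` controls D)"
proof -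
  show cont: "continuous_on (controls D) (\<lambda>a. (a, z_arg D S a i (central_diff S i), disc_B S a (un S) $ i))"
    by (intro continuous_on_Pair continuous_on_id continuous_on_z_arg[OF levy A S] continuous_on_disc_B[OF S])
  show "compact ((\<lambda>a. (a, z_arg D S a i (central_diff S i), disc_B S a (un S) $ i)) ` controls D)"
    using A by (intro compact_continuous_image cont) (simp add: assumption_A_def)
qed

text \<open>
  The part of \<open>\<G>\<^sup>\<alpha>\<close> that is linear in \<open>u\<close> is reproduced exactly by the row of \<open>\<L>\<close>, and so is the penalty
  near \<open>us\<close>. What remains is \<open>\<Delta>t\<close> times the remainder of \<open>f\<close> in \<open>y\<close>, which is \<open>o(s)\<close> uniformly in the
  control by the limit in Assumption S.
\<close>
lemma G_ctrl_newton:
  fixes D :: "('a::metric_space, 'd::finite, 'n::finite) control_data"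
    and S :: "('a, 'd, 'm::finite) scheme_data"
  assumes levy: "levy_measure (levy D)" and A: "assumption_A D"
    and dfS: "assumption_S D df \<mu>" and S: "valid_scheme D S" and \<epsilon>: "\<epsilon> > 0"
  shows "\<exists>\<delta>>0. \<forall>a\<in>controls D. \<forall>u. norm (u - us) < \<delta> \<longrightarrow>
    \<bar>G_ctrl D S a u $ i - G_ctrl D S a us $ i - L_row D S df i a u \<bullet> (u - us)\<bar> \<le> \<epsilon> * norm (u - us)"
proof -
  define \<kappa> where "\<kappa> = (\<lambda>a. (a, z_arg D S a i (central_diff S i), disc_B S a (un S) $ i))"
  let ?t = "tn S" let ?x = "node S i" let ?y = "us $ i" let ?\<zeta> = "obstacle D (tn S) (node S i)"
  have tau: "tstep S > 0" and t: "?t \<in> {0..horizon D}" using S by (auto simp: valid_scheme_def)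
  have K: "compact (\<kappa> ` controls D)" "\<kappa> ` controls D \<subseteq> controls D \<times> UNIV \<times> UNIV"
    using compact_scheme_arguments(2)[OF levy A S] by (auto simp: \<kappa>_def)
  have "uniform_limit (\<kappa> ` controls D)
      (\<lambda>s (a, z, k). (driver D a ?t ?x (?y + s) z k - driver D a ?t ?x ?y z k - df a ?t ?x (?y + s) z k * s) / s)
      (\<lambda>_. 0) (at 0)"
    using dfS t K unfolding assumption_S_def Let_def by blast
  from uniform_limitD[OF this, of "\<epsilon> / tstep S"]
  obtain \<delta>1 where \<delta>1: "\<delta>1 > 0" and lim: "\<And>s a. s \<noteq> 0 \<Longrightarrow> \<bar>s\<bar> < \<delta>1 \<Longrightarrow> a \<in> controls D \<Longrightarrow>
      \<bar>(driver D a ?t ?x (?y + s) (z_arg D S a i (central_diff S i)) (disc_B S a (un S) $ i)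
        - driver D a ?t ?x ?y (z_arg D S a i (central_diff S i)) (disc_B S a (un S) $ i)
        - df_at D S df i a (?y + s) * s) / s\<bar> < \<epsilon> / tstep S"
    using \<epsilon> tau by (auto simp: eventually_at dist_real_def \<kappa>_def)
  obtain \<delta>2 where \<delta>2: "\<delta>2 > 0" and pen: "\<And>s. \<bar>s\<bar> < \<delta>2 \<Longrightarrow>
      max (?\<zeta> - (?y + s)) 0 - max (?\<zeta> - ?y) 0 + of_bool (?\<zeta> - (?y + s) > 0) * s = 0"
    using penalty_newton_exact by blast
  have "\<bar>G_ctrl D S a u $ i - G_ctrl D S a us $ i - L_row D S df i a u \<bullet> (u - us)\<bar> \<le> \<epsilon> * norm (u - us)"
    if a: "a \<in> controls D" and u: "norm (u - us) < min \<delta>1 \<delta>2" for a u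
  proof -
    define s where "s = (u - us) $ i"
    have s_le: "\<bar>s\<bar> \<le> norm (u - us)" unfolding s_def by (rule component_le_norm_cart)
    have ui: "u $ i = ?y + s" by (simp add: s_def)
    define d where "d = driver D a ?t ?x (?y + s) (z_arg D S a i (central_diff S i)) (disc_B S a (un S) $ i)
        - driver D a ?t ?x ?y (z_arg D S a i (central_diff S i)) (disc_B S a (un S) $ i)
        - df_at D S df i a (?y + s) * s"
    define q where "q = max (?\<zeta> - (?y + s)) 0 - max (?\<zeta> - ?y) 0 + of_bool (?\<zeta> - (?y + s) > 0) * s"
    have "q = 0" unfolding q_def using pen u s_le by simp
    moreover have "G_ctrl D S a u $ i - G_ctrl D S a us $ i - L_row D S df i a u \<bullet> (u - us)
        = - tstep S * (d + penalty D * q)"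
      unfolding L_row_inner G_ctrl_def f_tilde_def f_bar_def d_def q_def
      by (simp add: ui matrix_vector_mult_diff_distrib algebra_simps)
    ultimately have eq: "\<bar>G_ctrl D S a u $ i - G_ctrl D S a us $ i - L_row D S df i a u \<bullet> (u - us)\<bar>
        = tstep S * \<bar>d\<bar>"
      using tau by (simp add: abs_mult)
    have "\<bar>d\<bar> \<le> \<epsilon> / tstep S * \<bar>s\<bar>"
    proof (cases "s = 0")
      case False
      then have "\<bar>d / s\<bar> < \<epsilon> / tstep S" unfolding d_def using a u s_le by (intro lim) auto
      then show ?thesis using False by (simp add: abs_divide pos_divide_less_eq)
    qed (simp add: d_def)
    also have "\<dots> \<le> \<epsilon> / tstep S * norm (u - us)"
      using s_le \<epsilon> tau by (intro mult_left_mono) auto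
    finally show ?thesis using tau unfolding eq by (simp add: field_simps)
  qed
  then show ?thesis using \<delta>1 \<delta>2 by (intro exI[of _ "min \<delta>1 \<delta>2"]) auto
qed

text \<open>
  The penalty part of the row is the same for all controls, so its jump in \<open>u\<close> cancels in the
  difference. What is left is the continuity of \<open>A\<close> in the control and the equicontinuity in Assumption S,
  whose modulus is uniform for values of \<open>y\<close> near \<open>us\<^sub>i\<close>.
\<close>
lemma L_row_equicontinuous:
  fixes D :: "('a::metric_space, 'd::finite, 'n::finite) control_data"
    and S :: "('a, 'd, 'm::finite) scheme_data"
  assumes levy: "levy_measure (levy D)" and A: "assumption_A D"
    and dfS: "assumption_S D df \<mu>" and S: "valid_scheme D S"
    and p: "p \<in> controls D" and \<epsilon>: "\<epsilon> > 0"
  shows "\<exists>\<delta>>0. \<forall>a\<in>controls D. \<forall>u. dist a p < \<delta> \<longrightarrow> norm (u - us) < \<delta> \<longrightarrow>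
    norm (L_row D S df i a u - L_row D S df i p u) \<le> \<epsilon>"
proof -
  define \<kappa> where "\<kappa> = (\<lambda>a. (a, z_arg D S a i (central_diff S i), disc_B S a (un S) $ i))"
  let ?t = "tn S" let ?x = "node S i"
  have tau: "tstep S > 0" and t: "?t \<in> {0..horizon D}" using S by (auto simp: valid_scheme_def)
  have K: "compact (\<kappa> ` controls D)" "\<kappa> ` controls D \<subseteq> controls D \<times> UNIV \<times> UNIV"
    and \<kappa>: "continuous_on (controls D) \<kappa>"
    using compact_scheme_arguments[OF levy A S] by (auto simp: \<kappa>_def)
  \<comment> \<open>Half of \<open>\<epsilon>\<close> for \<open>\<partial>\<^sup>o\<^sub>yf\<close> and half for \<open>A\<close>, before multiplication by the time step.\<close>
  define \<epsilon>' where "\<epsilon>' = \<epsilon> / (2 * tstep S)"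
  have \<epsilon>': "\<epsilon>' > 0" using \<epsilon> tau by (simp add: \<epsilon>'_def)
  from dfS[unfolded assumption_S_def Let_def, THEN conjunct2, THEN bspec, OF t,
      THEN spec[of _ "node S i"], THEN spec[of _ "us $ i"], THEN spec, THEN mp, OF conjI[OF K]]
  obtain U where U: "open U" "us $ i \<in> U" and eqc: "\<forall>p\<in>\<kappa> ` controls D. \<forall>\<epsilon>>0. \<exists>\<delta>>0. \<forall>v\<in>U. \<forall>q\<in>\<kappa> ` controls D.
      dist q p < \<delta> \<longrightarrow> dist (case q of (a, z, k) \<Rightarrow> df a ?t ?x v z k) (case p of (a, z, k) \<Rightarrow> df a ?t ?x v z k) < \<epsilon>"
    by (elim exE conjE) (rule that; assumption)
  obtain \<delta>1 where \<delta>1: "\<delta>1 > 0" and eqc': "\<forall>v\<in>U. \<forall>q\<in>\<kappa> ` controls D.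
      dist q (\<kappa> p) < \<delta>1 \<longrightarrow> dist (case q of (a, z, k) \<Rightarrow> df a ?t ?x v z k) (case \<kappa> p of (a, z, k) \<Rightarrow> df a ?t ?x v z k) < \<epsilon>'"
    using eqc p \<epsilon>' by blast
  obtain \<delta>2 where \<delta>2: "\<delta>2 > 0" and near: "\<And>a. a \<in> controls D \<Longrightarrow> dist a p < \<delta>2 \<Longrightarrow> dist (\<kappa> a) (\<kappa> p) < \<delta>1"
    using \<kappa> p \<delta>1 unfolding continuous_on_iff by metis
  have "continuous_on (controls D) (\<lambda>a. disc_A S a $ i)"
    using S by (auto simp: valid_scheme_def intro!: continuous_intros)
  then obtain \<delta>3 where \<delta>3: "\<delta>3 > 0"
    and nearA: "\<And>a. a \<in> controls D \<Longrightarrow> dist a p < \<delta>3 \<Longrightarrow> dist (disc_A S a $ i) (disc_A S p $ i) < \<epsilon>'"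
    using p \<epsilon>' unfolding continuous_on_iff by metis
  obtain \<delta>4 where \<delta>4: "\<delta>4 > 0" and ball: "\<And>y. dist y (us $ i) < \<delta>4 \<Longrightarrow> y \<in> U"
    using U unfolding open_dist by blast
  define \<delta> where "\<delta> = min (min \<delta>2 \<delta>3) \<delta>4"
  have "norm (L_row D S df i a u - L_row D S df i p u) \<le> \<epsilon>"
    if a: "a \<in> controls D" "dist a p < \<delta>" and u: "norm (u - us) < \<delta>" for a u
  proof -
    let ?\<Delta> = "df_at D S df i a (u $ i) - df_at D S df i p (u $ i)"
    have "dist (u $ i) (us $ i) \<le> norm (u - us)"
      using component_le_norm_cart[of "u - us" i] by (simp add: dist_real_def)
    then have "u $ i \<in> U" using u ball by (auto simp: \<delta>_def)
    with eqc' near[of a] a have df: "\<bar>?\<Delta>\<bar> < \<epsilon>'"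
      by (force simp: \<delta>_def \<kappa>_def dist_real_def)
    have "norm (disc_A S a $ i - disc_A S p $ i) < \<epsilon>'"
      using nearA[of a] a by (simp add: \<delta>_def dist_norm)
    moreover have "L_row D S df i a u - L_row D S df i p u
        = - tstep S *\<^sub>R (?\<Delta> *\<^sub>R axis i 1 + (disc_A S a $ i - disc_A S p $ i))"
      unfolding vec_eq_iff by (auto simp: L_row_nth axis_def algebra_simps)
    then have "norm (L_row D S df i a u - L_row D S df i p u)
        = tstep S * norm (?\<Delta> *\<^sub>R axis i 1 + (disc_A S a $ i - disc_A S p $ i))"
      using tau by simp
    moreover have "norm (?\<Delta> *\<^sub>R axis i 1 + (disc_A S a $ i - disc_A S p $ i))
        \<le> \<bar>?\<Delta>\<bar> + norm (disc_A S a $ i - disc_A S p $ i)"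
      using norm_triangle_ineq[of "?\<Delta> *\<^sub>R axis i 1" "disc_A S a $ i - disc_A S p $ i"]
      by (simp add: norm_axis_1)
    ultimately have "norm (L_row D S df i a u - L_row D S df i p u) \<le> tstep S * (\<epsilon>' + \<epsilon>')"
      using df tau by simp
    then show ?thesis using tau by (simp add: \<epsilon>'_def)
  qed
  then show ?thesis using \<delta>2 \<delta>3 \<delta>4 by (intro exI[of _ \<delta>]) (auto simp: \<delta>_def)
qed

lemma G_inf_newton:
  fixes D :: "('a::metric_space, 'd::finite, 'n::finite) control_data"
    and S :: "('a, 'd, 'm::finite) scheme_data"
  assumes levy: "levy_measure (levy D)" and A: "assumption_A D"
    and dfS: "assumption_S D df \<mu>" and S: "valid_scheme D S" and \<epsilon>: "\<epsilon> > 0"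
  shows "\<exists>\<delta>>0. \<forall>u \<alpha>. norm (u - us) < \<delta> \<longrightarrow>
    (\<forall>i. is_arg_min (\<lambda>a. G_ctrl D S a u $ i) (\<lambda>a. a \<in> controls D) (\<alpha> i)) \<longrightarrow>
    infnorm (G_inf D S u - G_inf D S us - L_mat D S df \<alpha> u *v (u - us)) \<le> \<epsilon> * norm (u - us)"
proof -
  have "compact (controls D)" using A by (simp add: assumption_A_def)
  from newton_derivative_INF[OF this continuous_on_G_ctrl[OF levy A S] G_ctrl_newton[OF levy A dfS S]
      L_row_equicontinuous[OF levy A dfS S] \<epsilon>]
  have "\<forall>i. \<exists>\<delta>>0. \<forall>u a. norm (u - us) < \<delta> \<longrightarrow> is_arg_min (\<lambda>a. G_ctrl D S a u $ i) (\<lambda>a. a \<in> controls D) a \<longrightarrow>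
      \<bar>(INF a\<in>controls D. G_ctrl D S a u $ i) - (INF a\<in>controls D. G_ctrl D S a us $ i)
        - L_row D S df i a u \<bullet> (u - us)\<bar> \<le> \<epsilon> * norm (u - us)"
    by blast
  then obtain \<delta> where \<delta>: "\<And>i. \<delta> i > 0" and est: "\<And>i u a. norm (u - us) < \<delta> i \<Longrightarrow>
      is_arg_min (\<lambda>a. G_ctrl D S a u $ i) (\<lambda>a. a \<in> controls D) a \<Longrightarrow>
      \<bar>(INF a\<in>controls D. G_ctrl D S a u $ i) - (INF a\<in>controls D. G_ctrl D S a us $ i)
        - L_row D S df i a u \<bullet> (u - us)\<bar> \<le> \<epsilon> * norm (u - us)"
    by metis
  define \<delta>0 where "\<delta>0 = Min (range \<delta>)"
  have \<delta>0: "\<delta>0 > 0" "\<delta>0 \<le> \<delta> i" for i using \<delta> by (auto simp: \<delta>0_def)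
  have "infnorm (G_inf D S u - G_inf D S us - L_mat D S df \<alpha> u *v (u - us)) \<le> \<epsilon> * norm (u - us)"
    if u: "norm (u - us) < \<delta>0"
      and \<alpha>: "\<forall>i. is_arg_min (\<lambda>a. G_ctrl D S a u $ i) (\<lambda>a. a \<in> controls D) (\<alpha> i)" for u \<alpha>
  proof (rule infnorm_leI)
    fix i
    have "norm (u - us) < \<delta> i" using u \<delta>0(2)[of i] by simp
    from est[OF this \<alpha>[rule_format, of i]]
    show "\<bar>(G_inf D S u - G_inf D S us - L_mat D S df \<alpha> u *v (u - us)) $ i\<bar> \<le> \<epsilon> * norm (u - us)"
      by (simp add: G_inf_def matrix_vector_mul_component L_mat_row)
  qed
  then show ?thesis using \<delta>0(1) by blast
qed

theorem theorem5p3: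
  fixes D :: "('a::metric_space, 'd::finite, 'n::finite) control_data"
    and S :: "('a, 'd, 'm::finite) scheme_data"
    and df :: "'a \<Rightarrow> real \<Rightarrow> real^'d \<Rightarrow> real \<Rightarrow> real^'d \<Rightarrow> real \<Rightarrow> real"
    and \<mu> c\<^sub>0 :: real
  assumes "horizon D > 0" and "levy_measure (levy D)" and "penalty D \<ge> 0"
    and "assumption_A D"
    and "assumption_S D df \<mu>"
    and "valid_scheme D S"
    and "1 - \<mu> * tstep S \<ge> c\<^sub>0" and "c\<^sub>0 > 0"
  shows "(\<forall>\<alpha> u. (\<forall>i. \<alpha> i \<in> controls D) \<longrightarrow>
            invertible (L_mat D S df \<alpha> u) \<and>
            matrix_norm0 (matrix_inv (L_mat D S df \<alpha> u)) \<le> 1 / c\<^sub>0) \<and>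
         (\<forall>us. G_inf D S us = 0 \<longrightarrow>
            (\<exists>N. open N \<and> us \<in> N \<and>
              (\<forall>\<alpha> u. policy_iteration D S df \<alpha> u \<and> u 0 \<in> N \<longrightarrow>
                 u \<longlonglongrightarrow> us \<and>
                 (\<lambda>k. infnorm (u (Suc k) - us)) \<in> o(\<lambda>k. infnorm (u k - us)))))"
proof (intro conjI allI impI)
  fix \<alpha> :: "'m \<Rightarrow> 'a" and u :: "real^'m"
  assume \<alpha>: "\<forall>i. \<alpha> i \<in> controls D"
  have lower: "c\<^sub>0 * infnorm v \<le> infnorm (L_mat D S df \<alpha> u *v v)" for v
    using L_mat_infnorm_ge[OF assms(3,5,6,7)] \<alpha> by blast
  show "invertible (L_mat D S df \<alpha> u)"
    and "matrix_norm0 (matrix_inv (L_mat D S df \<alpha> u)) \<le> 1 / c\<^sub>0"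
    using invertible_matrix_norm0_inv_le[OF lower assms(8)] by auto
next
  fix us :: "real^'m"
  assume us: "G_inf D S us = 0"
  define R where "R = (\<lambda>v w. \<exists>\<beta>. (\<forall>i. is_arg_min (\<lambda>a. G_ctrl D S a v $ i) (\<lambda>a. a \<in> controls D) (\<beta> i)) \<and>
      G_inf D S v + L_mat D S df \<beta> v *v (w - v) = 0)"
  have "\<exists>\<delta>>0. \<forall>v w. infnorm (v - us) < \<delta> \<longrightarrow> R v w \<longrightarrow> infnorm (w - us) \<le> \<epsilon> * infnorm (v - us)"
    if \<epsilon>: "\<epsilon> > 0" for \<epsilon>
  proof -
    \<comment> \<open>The factor \<open>?m\<close> compares the Euclidean norm, in which the expansion of \<open>\<G>\<close> is stated, with the max norm.\<close>
    let ?m = "sqrt (real DIM(real^'m))"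
    have m: "?m > 0" by simp
    obtain \<delta> where \<delta>: "\<delta> > 0" and est: "\<And>v \<beta>. norm (v - us) < \<delta> \<Longrightarrow>
        (\<And>i. is_arg_min (\<lambda>a. G_ctrl D S a v $ i) (\<lambda>a. a \<in> controls D) (\<beta> i)) \<Longrightarrow>
        infnorm (G_inf D S v - G_inf D S us - L_mat D S df \<beta> v *v (v - us)) \<le> c\<^sub>0 * \<epsilon> / ?m * norm (v - us)"
      using G_inf_newton[OF assms(2,4,5,6), of "c\<^sub>0 * \<epsilon> / ?m" us] \<epsilon> assms(8) m by (metis divide_pos_pos mult_pos_pos)
    have "infnorm (w - us) \<le> \<epsilon> * infnorm (v - us)"
      if v: "infnorm (v - us) < \<delta> / ?m" and "R v w" for v w
    proof -
      obtain \<beta> where \<beta>: "\<And>i. is_arg_min (\<lambda>a. G_ctrl D S a v $ i) (\<lambda>a. a \<in> controls D) (\<beta> i)"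
        and eq: "G_inf D S v + L_mat D S df \<beta> v *v (w - v) = 0"
        using \<open>R v w\<close> unfolding R_def by blast
      have norm_le: "norm (v - us) \<le> ?m * infnorm (v - us)" by (rule norm_le_infnorm)
      also have "\<dots> < \<delta>" using v m by (simp add: pos_less_divide_eq mult.commute)
      finally have small: "norm (v - us) < \<delta>" .
      have "L_mat D S df \<beta> v *v (w - us) = L_mat D S df \<beta> v *v (w - v) + L_mat D S df \<beta> v *v (v - us)"
        by (simp flip: matrix_vector_right_distrib)
      also have "\<dots> = - (G_inf D S v - G_inf D S us - L_mat D S df \<beta> v *v (v - us))"
        using eq us by (simp add: algebra_simps eq_neg_iff_add_eq_0)
      finally have "infnorm (L_mat D S df \<beta> v *v (w - us))
          = infnorm (G_inf D S v - G_inf D S us - L_mat D S df \<beta> v *v (v - us))"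
        by (simp only: infnorm_neg)
      moreover have "\<beta> i \<in> controls D" for i using \<beta>[of i] by (simp add: is_arg_min_def)
      then have "c\<^sub>0 * infnorm (w - us) \<le> infnorm (L_mat D S df \<beta> v *v (w - us))"
        by (rule L_mat_infnorm_ge[OF assms(3,5,6,7)])
      ultimately have "c\<^sub>0 * infnorm (w - us) \<le> c\<^sub>0 * \<epsilon> / ?m * norm (v - us)"
        using est[OF small \<beta>] by linarith
      also have "\<dots> \<le> c\<^sub>0 * \<epsilon> / ?m * (?m * infnorm (v - us))"
        using norm_le \<epsilon> assms(8) by (intro mult_left_mono) auto
      also have "\<dots> = c\<^sub>0 * (\<epsilon> * infnorm (v - us))" using m by (simp add: field_simps)
      finally show ?thesis using assms(8) by simp
    qed
    moreover have "\<delta> / ?m > 0" using \<delta> m by (rule divide_pos_pos)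
    ultimately show ?thesis by blast
  qed
  from locally_superlinear[of us R, OF this] obtain N where N: "open N" "us \<in> N"
    and conv: "\<And>u. (\<forall>k. R (u k) (u (Suc k))) \<Longrightarrow> u 0 \<in> N \<Longrightarrow>
      u \<longlonglongrightarrow> us \<and> (\<lambda>k. infnorm (u (Suc k) - us)) \<in> o(\<lambda>k. infnorm (u k - us))"
    by blast
  have "\<forall>k. R (u k) (u (Suc k))" if "policy_iteration D S df \<alpha> u" for \<alpha> u
    using that unfolding policy_iteration_def R_def by blast
  with N conv show "\<exists>N. open N \<and> us \<in> N \<and>
      (\<forall>\<alpha> u. policy_iteration D S df \<alpha> u \<and> u 0 \<in> N \<longrightarrow>
        u \<longlonglongrightarrow> us \<and> (\<lambda>k. infnorm (u (Suc k) - us)) \<in> o(\<lambda>k. infnorm (u k - us)))"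
    by (intro exI[of _ N]) blast
qed

end
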